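(* Let $G=(V,E)$ be a connected (finite, undirected) graph, and let $\mathcal{C}$ be a crossing family over ground set $V$ such that $|\delta_G(U)|\geq 2$ for all $U\in\mathcal{C}$, where $\delta_G(U)$ denotes the set of edges of $G$ with exactly one endpoint in $U$. Then there exists a strong orientation of $G$ for $\mathcal{C}$, i.e., an orientation $\overrightarrow{G}$ of the edges of $G$ such that for every $U\in\mathcal{C}$, $\overrightarrow{G}$ has at least one arc leaving $U$ (tail in $U$, head in $V\setminus U$) and at least one arc entering $U$ (tail in $V\setminus U$, head in $U$).
   Context: A family $\mathcal{C}\subseteq 2^V$ is a crossing family over ground set $V$ if $U\cap W\in\mathcal{C}$ and $U\cup W\in\mathcal{C}$ for all $U,W\in\mathcal{C}$ that cross, i.e., $U\cap W\neq\emptyset$ and $U\cup W\neq V$. *)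

theory Defs
  imports "Graph_Theory.Digraph"
begin

text \<open>
  Finite undirected graphs. Parallel edges and loops are allowed, as edges have an identity of
  their own and the map \<open>ends\<close> sends each edge to the set of its one or two endpoints.
  Simple graphs are the case where \<open>E\<close> consists of 2-element subsets of \<open>V\<close> and \<open>ends\<close> is the
  identity.
\<close>

locale fin_multigraph =
  fixes V :: "'v set" and E :: "'e set" and ends :: "'e \<Rightarrow> 'v set"
  assumes finite_V: "finite V"
    and finite_E: "finite E"
    and ends_edge: "e \<in> E \<Longrightarrow> \<exists>u\<in>V. \<exists>v\<in>V. ends e = {u, v}"

definition adjacency :: "'e set \<Rightarrow> ('e \<Rightarrow> 'v set) \<Rightarrow> ('v \<times> 'v) set" where
  "adjacency E ends = {(u, v). \<exists>e\<in>E. ends e = {u, v}}"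

definition connected_multigraph :: "'v set \<Rightarrow> 'e set \<Rightarrow> ('e \<Rightarrow> 'v set) \<Rightarrow> bool" where
  "connected_multigraph V E ends \<longleftrightarrow> (\<forall>u\<in>V. \<forall>v\<in>V. (u, v) \<in> (adjacency E ends)\<^sup>*)"

definition cut_edges :: "'v set \<Rightarrow> 'e set \<Rightarrow> ('e \<Rightarrow> 'v set) \<Rightarrow> 'v set \<Rightarrow> 'e set" where
  "cut_edges V E ends U = {e \<in> E. \<exists>u\<in>U. \<exists>v\<in>V - U. ends e = {u, v}}"

definition crossing_family :: "'v set \<Rightarrow> 'v set set \<Rightarrow> bool" where
  "crossing_family V C \<longleftrightarrow>
     C \<subseteq> Pow V \<and>
     (\<forall>U\<in>C. \<forall>W\<in>C. U \<inter> W \<noteq> {} \<and> U \<union> W \<noteq> V \<longrightarrow> U \<inter> W \<in> C \<and> U \<union> W \<in> C)"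

definition orientation ::
    "'v set \<Rightarrow> 'e set \<Rightarrow> ('e \<Rightarrow> 'v set) \<Rightarrow> ('v, 'e) pre_digraph \<Rightarrow> bool" where
  "orientation V E ends D \<longleftrightarrow>
     verts D = V \<and> arcs D = E \<and> (\<forall>e\<in>E. {tail D e, head D e} = ends e)"

definition arcs_leaving :: "('v, 'e) pre_digraph \<Rightarrow> 'v set \<Rightarrow> 'e set" where
  "arcs_leaving D U = {a \<in> arcs D. tail D a \<in> U \<and> head D a \<in> verts D - U}"

definition arcs_entering :: "('v, 'e) pre_digraph \<Rightarrow> 'v set \<Rightarrow> 'e set" where
  "arcs_entering D U = {a \<in> arcs D. tail D a \<in> verts D - U \<and> head D a \<in> U}"

definition strong_orientation ::
    "'v set \<Rightarrow> 'e set \<Rightarrow> ('e \<Rightarrow> 'v set) \<Rightarrow> 'v set set \<Rightarrow> ('v, 'e) pre_digraph \<Rightarrow> bool" where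
  "strong_orientation V E ends C D \<longleftrightarrow>
     orientation V E ends D \<and>
     (\<forall>U\<in>C. arcs_leaving D U \<noteq> {} \<and> arcs_entering D U \<noteq> {})"

end

theory Submission
  imports Defs Complex_Main
begin

text \<open>
  Fix any reference orientation, with \<open>out U\<close> and \<open>inn U\<close> counting the arcs leaving and entering \<open>U\<close>.
  It suffices to find an integer vector \<open>y\<close> on \<open>V\<close> with \<open>y(V) = 0\<close> and
  \<open>1 - inn U \<le> y(U) \<le> out U - 1\<close> for all \<open>U \<in> C\<close>. Since the graph is connected, \<open>y\<close> is the net outflow
  of an integer, possibly unbounded, flow \<open>x\<close> on the edges; keep the edges with \<open>x \<ge> 1\<close> and reverse
  the others. If no arc of the result left \<open>U\<close>, then \<open>x \<le> 0\<close> on the edges that leave \<open>U\<close> in the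
  reference orientation and \<open>x \<ge> 1\<close> on those that enter it, so \<open>y(U) \<le> - inn U\<close>, which is impossible;
  entering arcs are symmetric.
  Half of the net outdegree is a fractional solution for \<open>y\<close>, because every cut has at least two edges.
  An integral one exists because the intersection of two base polyhedra of crossing submodular
  functions is integral.
\<close>

section \<open>Integrality over crossing families\<close>

text \<open>Two overlapping members of \<open>S\<close> can be replaced by their union, which
  shortens \<open>S\<close> and keeps \<open>\<Union>S\<close>. This ends with disjoint sets, whose
  sums add up, or with a union equal to \<open>V\<close>. Only unions are involved, so the lemma can
  be applied both to a crossing family and to a family of complements.\<close>

lemma sum_Union_Ints:
  fixes y :: "'v \<Rightarrow> real"
  assumes "finite V" "F \<subseteq> Pow V" "sum y V \<in> \<int>"
    and int: "\<And>U. U \<in> F \<Longrightarrow> sum y U \<in> \<int>"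
    and merge: "\<And>U W. \<lbrakk>U \<in> F; W \<in> F; U \<inter> W \<noteq> {}; U \<union> W \<noteq> V\<rbrakk> \<Longrightarrow> U \<union> W \<in> F"
    and "S \<subseteq> F"
  shows "sum y (\<Union>S) \<in> \<int>"
  using \<open>S \<subseteq> F\<close>
proof (induction "card S" arbitrary: S rule: less_induct)
  case less
  have finS: "finite S"
    using less.prems assms(1,2) by (meson finite_Pow_iff finite_subset)
  show ?case
  proof (cases "\<forall>U\<in>S. \<forall>W\<in>S. U \<noteq> W \<longrightarrow> U \<inter> W = {}")
    case True
    have "\<forall>U\<in>S. finite U"
      using less.prems assms(1,2) by (meson PowD finite_subset subsetD)
    then have "sum y (\<Union>S) = (\<Sum>U\<in>S. sum y U)"
      using True by (simp add: sum.Union_disjoint)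
    then show ?thesis
      using int less.prems by (simp add: Ints_sum subset_iff)
  next
    case False
    then obtain U W where UW: "U \<in> S" "W \<in> S" "U \<noteq> W" "U \<inter> W \<noteq> {}"
      by blast
    show ?thesis
    proof (cases "U \<union> W = V")
      case True
      then have "\<Union>S = V"
        using UW less.prems assms(2) by blast
      then show ?thesis
        using assms(3) by simp
    next
      case False
      let ?S = "insert (U \<union> W) (S - {U, W})"
      have "card ?S \<le> Suc (card (S - {U, W}))"
        by (simp add: card_insert_le_m1 finS card_insert_if)
      moreover have "card (S - {U, W}) = card S - 2" "card S \<ge> 2"
        using UW finS card_mono[of S "{U, W}"] by (auto simp: card_Diff_subset)
      ultimately have "card ?S < card S"
        by linarith
      moreover have "?S \<subseteq> F"
        using merge UW False less.prems by blast
      ultimately have "sum y (\<Union>?S) \<in> \<int>"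
        using less.hyps by blast
      moreover have "\<Union>?S = \<Union>S"
        using UW by blast
      ultimately show ?thesis
        by simp
    qed
  qed
qed

text \<open>The atom of \<open>v\<close> consists of the points lying in exactly the same members of
  \<open>F\<close> as \<open>v\<close>. It is obtained in two rounds of
  \<open>sum_Union_Ints\<close>: first for unions of members, then for complements of such unions,
  which yields integral sums over intersections.\<close>

lemma sum_atom_Ints:
  fixes y :: "'v \<Rightarrow> real"
  assumes "finite V" "crossing_family V F" "sum y V \<in> \<int>"
    and int: "\<And>U. U \<in> F \<Longrightarrow> sum y U \<in> \<int>"
    and "v \<in> V"
  shows "sum y {u \<in> V. {U \<in> F. u \<in> U} = {U \<in> F. v \<in> U}} \<in> \<int>"
proof -
  have sub: "F \<subseteq> Pow V"
    and cross: "\<And>U W. \<lbrakk>U \<in> F; W \<in> F; U \<inter> W \<noteq> {}; U \<union> W \<noteq> V\<rbrakk> \<Longrightarrow> U \<inter> W \<in> F \<and> U \<union> W \<in> F"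
    using assms(2) unfolding crossing_family_def by auto
  define G where "G = Union ` Pow F"
  have Gsub: "G \<subseteq> Pow V"
    using sub unfolding G_def by blast
  have Gint: "sum y X \<in> \<int>" if "X \<in> G" for X
  proof -
    obtain S where "S \<subseteq> F" "X = \<Union>S"
      using \<open>X \<in> G\<close> unfolding G_def by blast
    moreover have "sum y (\<Union>S) \<in> \<int>"
    proof (rule sum_Union_Ints[OF assms(1) sub assms(3) int])
      show "U \<union> W \<in> F" if "U \<in> F" "W \<in> F" "U \<inter> W \<noteq> {}" "U \<union> W \<noteq> V" for U W
        using cross[OF that] by (rule conjunct2)
    qed (use \<open>S \<subseteq> F\<close> in auto)
    ultimately show ?thesis
      by simp
  qed
  have Ginter: "X \<inter> Y \<in> G" if "X \<in> G" "Y \<in> G" "X \<union> Y \<noteq> V" for X Y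
  proof -
    obtain S T where ST: "S \<subseteq> F" "T \<subseteq> F" "X = \<Union>S" "Y = \<Union>T"
      using \<open>X \<in> G\<close> \<open>Y \<in> G\<close> unfolding G_def by blast
    \<comment> \<open>Intersection distributes over the two unions. Empty pieces are dropped because
      crossing puts only nonempty intersections into \<open>F\<close>; \<open>{} \<in> G\<close>
      still holds, as the empty union.\<close>
    let ?R = "{A \<inter> B | A B. A \<in> S \<and> B \<in> T \<and> A \<inter> B \<noteq> {}}"
    have "?R \<subseteq> F"
    proof
      fix Z assume "Z \<in> ?R"
      then obtain A B where AB: "Z = A \<inter> B" "A \<in> S" "B \<in> T" "A \<inter> B \<noteq> {}"
        by blast
      have "X \<union> Y \<subseteq> V"
        using that Gsub by blast
      then have "A \<union> B \<noteq> V"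
        using AB ST that(3) by blast
      then show "Z \<in> F"
        using AB ST cross by blast
    qed
    moreover have "X \<inter> Y = \<Union>?R"
      using ST by blast
    ultimately show ?thesis
      unfolding G_def by blast
  qed
  have compl: "sum y (V - X) \<in> \<int>" if "X \<subseteq> V" "sum y X \<in> \<int>" for X
    using that assms(1,3) by (simp add: sum_diff Ints_diff)
  \<comment> \<open>The set is the intersection of \<open>T\<close> taken inside \<open>V\<close>,
    hence \<open>V\<close> for empty \<open>T\<close>. Two complements meet exactly when the
    originals do not cover \<open>V\<close>, which is the case handled by
    \<open>Ginter\<close>.\<close>
  have inter: "sum y (V - (\<Union>X\<in>T. V - X)) \<in> \<int>" if "T \<subseteq> G" for T
  proof (rule compl)
    let ?H = "(\<lambda>X. V - X) ` G"
    show "sum y (\<Union>X\<in>T. V - X) \<in> \<int>"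
    proof (rule sum_Union_Ints[of V ?H])
      fix U assume "U \<in> ?H"
      then show "sum y U \<in> \<int>"
        using compl Gint Gsub by blast
    next
      fix U W assume UW: "U \<in> ?H" "W \<in> ?H" "U \<inter> W \<noteq> {}"
      then obtain X Y where "U = V - X" "W = V - Y" "X \<in> G" "Y \<in> G"
        by blast
      moreover from this have "X \<union> Y \<noteq> V"
        using UW by blast
      ultimately have "U \<union> W = V - X \<inter> Y" "X \<inter> Y \<in> G"
        using Ginter by auto
      then show "U \<union> W \<in> ?H"
        by blast
    qed (use assms that in auto)
  qed auto
  define T where "T = {U \<in> F. v \<in> U}"
  define X where "X = \<Union>{U \<in> F. v \<notin> U}"
  have X: "X \<in> G"
    unfolding X_def G_def by blast
  have T: "T \<subseteq> G"
    unfolding T_def G_def by blast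
  \<comment> \<open>\<open>?M\<close> is the intersection of the members containing
    \<open>v\<close>, and \<open>?L\<close> is its part covered by members missing \<open>v\<close>;
    the atom is what remains.\<close>
  let ?M = "V - (\<Union>X\<in>T. V - X)" and ?L = "V - (\<Union>X\<in>insert X T. V - X)"
  have "{u \<in> V. {U \<in> F. u \<in> U} = {U \<in> F. v \<in> U}} = ?M - ?L"
    unfolding X_def T_def by blast
  moreover have "sum y (?M - ?L) = sum y ?M - sum y ?L"
    using assms(1) by (intro sum_diff) auto
  moreover have "sum y ?M \<in> \<int>" "sum y ?L \<in> \<int>"
    using inter[of T] inter[of "insert X T"] T X by auto
  ultimately show ?thesis
    by (simp add: Ints_diff)
qed

section \<open>Kernel vectors\<close>

text \<open>Gaussian elimination: equation \<open>k\<close> is used to eliminate one variable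
  \<open>w\<close> with nonzero coefficient, leaving one equation and one variable fewer.\<close>

lemma homogeneous_system_nontrivial_solution:
  fixes a :: "'k \<Rightarrow> 'v \<Rightarrow> real"
  assumes "finite K" "finite N" "card K < card N"
  shows "\<exists>d. (\<exists>v\<in>N. d v \<noteq> 0) \<and> (\<forall>k\<in>K. (\<Sum>v\<in>N. a k v * d v) = 0)"
  using assms
proof (induction K arbitrary: N a rule: finite_induct)
  case empty
  then have "N \<noteq> {}"
    by auto
  then show ?case
    by (intro exI[of _ "\<lambda>_. 1"]) auto
next
  case (insert k K)
  show ?case
  proof (cases "\<forall>v\<in>N. a k v = 0")
    case True
    have "card K < card N"
      using insert by simp
    then obtain d where "\<exists>v\<in>N. d v \<noteq> 0" "\<forall>k\<in>K. (\<Sum>v\<in>N. a k v * d v) = 0"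
      using insert.IH insert.prems by blast
    then show ?thesis
      using True by (intro exI[of _ d]) auto
  next
    case False
    then obtain w where w: "w \<in> N" "a k w \<noteq> 0"
      by blast
    let ?N = "N - {w}"
    have "card K < card ?N"
      using insert w by simp
    then obtain d where d: "\<exists>v\<in>?N. d v \<noteq> 0"
      and eqs: "\<forall>j\<in>K. (\<Sum>v\<in>?N. (a j v - a j w * a k v / a k w) * d v) = 0"
      using insert.IH[of ?N "\<lambda>j v. a j v - a j w * a k v / a k w"] insert.prems by auto
    define s where "s = (\<Sum>v\<in>?N. a k v * d v)"
    \<comment> \<open>Back substitution: this value at \<open>w\<close> is the one that satisfies
      equation \<open>k\<close>.\<close>
    define d' where "d' = d(w := - s / a k w)"
    have split: "(\<Sum>v\<in>N. a j v * d' v) = (\<Sum>v\<in>?N. a j v * d v) - a j w * s / a k w" for j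
    proof -
      have "(\<Sum>v\<in>N. a j v * d' v) = a j w * d' w + (\<Sum>v\<in>?N. a j v * d' v)"
        using w insert.prems by (simp add: sum.remove)
      also have "(\<Sum>v\<in>?N. a j v * d' v) = (\<Sum>v\<in>?N. a j v * d v)"
        by (rule sum.cong) (auto simp: d'_def)
      finally show ?thesis
        by (simp add: d'_def)
    qed
    have "(\<Sum>v\<in>N. a j v * d' v) = 0" if "j \<in> insert k K" for j
    proof (cases "j = k")
      case True
      then show ?thesis
        using split[of k] w by (simp add: s_def)
    next
      case False
      have "(\<Sum>v\<in>?N. (a j v - a j w * a k v / a k w) * d v)
          = (\<Sum>v\<in>?N. a j v * d v) - a j w * s / a k w"
        by (simp add: s_def left_diff_distrib sum_subtractf sum_distrib_left sum_divide_distrib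
            mult.assoc)
      then show ?thesis
        using split[of j] eqs that False by auto
    qed
    moreover have "\<exists>v\<in>N. d' v \<noteq> 0"
      using d by (auto simp: d'_def)
    ultimately show ?thesis
      by blast
  qed
qed

lemma card_image_no_singleton_fibre:
  assumes "finite N" and "\<And>v. v \<in> N \<Longrightarrow> \<exists>w\<in>N. w \<noteq> v \<and> p w = p v"
  shows "2 * card (p ` N) \<le> card N"
proof -
  have "2 \<le> card {v \<in> N. p v = c}" if c: "c \<in> p ` N" for c
  proof -
    obtain v w where "v \<in> N" "w \<in> N" "w \<noteq> v" "p w = p v" "p v = c"
      using c assms(2) by blast
    then have "card {v, w} \<le> card {v \<in> N. p v = c}"
      using assms(1) by (intro card_mono) auto
    then show ?thesis
      using \<open>w \<noteq> v\<close> by simp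
  qed
  then have "(\<Sum>c\<in>p ` N. 2) \<le> (\<Sum>c\<in>p ` N. card {v \<in> N. p v = c})"
    by (rule sum_mono)
  also have "\<dots> = card N"
    using sum.image_gen[OF assms(1), of "\<lambda>_. 1::nat" p] by simp
  finally show ?thesis
    by simp
qed

text \<open>
  Fewer than \<open>card N\<close> equations are needed: the sums over the fibres of \<open>p\<close> determine the total,
  so one fibre of \<open>q\<close> may be omitted.
\<close>

lemma two_partitions_kernel:
  fixes p :: "'v \<Rightarrow> 'a" and q :: "'v \<Rightarrow> 'b"
  assumes "finite N" "N \<noteq> {}"
    and p: "\<And>v. v \<in> N \<Longrightarrow> \<exists>w\<in>N. w \<noteq> v \<and> p w = p v"
    and q: "\<And>v. v \<in> N \<Longrightarrow> \<exists>w\<in>N. w \<noteq> v \<and> q w = q v"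
  obtains d :: "'v \<Rightarrow> real" where "\<exists>v\<in>N. d v \<noteq> 0"
    and "\<And>c. (\<Sum>v | v \<in> N \<and> p v = c. d v) = 0" and "\<And>c. (\<Sum>v | v \<in> N \<and> q v = c. d v) = 0"
proof -
  obtain v0 where v0: "v0 \<in> N"
    using assms(2) by blast
  define K where "K = Inl ` p ` N \<union> Inr ` (q ` N - {q v0})"
  define a :: "'a + 'b \<Rightarrow> 'v \<Rightarrow> real" where
    "a k v = (case k of Inl c \<Rightarrow> of_bool (p v = c) | Inr c \<Rightarrow> of_bool (q v = c))" for k v
  have finK: "finite K"
    using assms(1) by (simp add: K_def)
  \<comment> \<open>Each partition has at most \<open>card N / 2\<close> blocks, so omitting the
    block of \<open>v0\<close> makes the count strictly smaller than \<open>card N\<close>.\<close>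
  have "card K = card (p ` N) + card (q ` N - {q v0})"
    unfolding K_def using assms(1)
    by (subst card_Un_disjoint) (auto simp: card_image)
  moreover have "card (q ` N - {q v0}) = card (q ` N) - 1" "card (q ` N) \<ge> 1"
    using v0 assms(1) by (auto simp: Suc_le_eq card_gt_0_iff)
  moreover have "2 * card (p ` N) \<le> card N" "2 * card (q ` N) \<le> card N"
    using card_image_no_singleton_fibre assms(1) p q by blast+
  ultimately have "card K < card N"
    by linarith
  then obtain d where d: "\<exists>v\<in>N. d v \<noteq> 0" "\<forall>k\<in>K. (\<Sum>v\<in>N. a k v * d v) = 0"
    using homogeneous_system_nontrivial_solution[OF finK assms(1)] by blast
  have ind: "(\<Sum>v\<in>N. of_bool (P v) * d v) = (\<Sum>v | v \<in> N \<and> P v. d v)" for P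
  proof -
    have "(\<Sum>v | v \<in> N \<and> P v. d v) = (\<Sum>v\<in>N. if P v then d v else 0)"
      using assms(1) by (simp add: sum.inter_filter)
    also have "\<dots> = (\<Sum>v\<in>N. of_bool (P v) * d v)"
      by (rule sum.cong) auto
    finally show ?thesis ..
  qed
  have P: "(\<Sum>v | v \<in> N \<and> p v = c. d v) = 0" for c
  proof (cases "c \<in> p ` N")
    case True
    then have "Inl c \<in> K"
      by (simp add: K_def)
    then show ?thesis
      using d(2) ind[of "\<lambda>v. p v = c"] by (force simp: a_def)
  next
    case False
    then have none: "{v. v \<in> N \<and> p v = c} = {}"
      by blast
    show ?thesis
      unfolding none by simp
  qed
  have Q': "(\<Sum>v | v \<in> N \<and> q v = c. d v) = 0" if "c \<noteq> q v0" for c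
  proof (cases "c \<in> q ` N")
    case True
    then have "Inr c \<in> K"
      using that by (simp add: K_def)
    then show ?thesis
      using d(2) ind[of "\<lambda>v. q v = c"] by (force simp: a_def)
  next
    case False
    then have none: "{v. v \<in> N \<and> q v = c} = {}"
      by blast
    show ?thesis
      unfolding none by simp
  qed
  have "sum d N = (\<Sum>c\<in>p ` N. \<Sum>v | v \<in> N \<and> p v = c. d v)"
    using assms(1) by (rule sum.image_gen)
  then have "sum d N = 0"
    using P by simp
  moreover have "sum d N = (\<Sum>c\<in>q ` N. \<Sum>v | v \<in> N \<and> q v = c. d v)"
    using assms(1) by (rule sum.image_gen)
  moreover have "\<dots> = (\<Sum>v | v \<in> N \<and> q v = q v0. d v)"
    using Q' v0 assms(1) by (subst sum.remove[of _ "q v0"]) auto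
  ultimately have "(\<Sum>v | v \<in> N \<and> q v = c. d v) = 0" for c
    using Q' by (cases "c = q v0") auto
  then show ?thesis
    using that d(1) P by blast
qed

section \<open>Integer points in the intersection of two base polyhedra\<close>

text \<open>A ratio test: \<open>\<alpha> i\<close> is the current excess of constraint
  \<open>i\<close> and \<open>\<beta> i\<close> its rate of change along a direction. Tight
  constraints have rate 0 and stay tight; the first increasing constraint to reach 0 becomes newly
  tight.\<close>

lemma move_until_tight:
  fixes \<alpha> \<beta> :: "'i \<Rightarrow> real"
  assumes "finite K" and feas: "\<And>i. i \<in> K \<Longrightarrow> \<alpha> i \<le> 0"
    and tight: "\<And>i. \<lbrakk>i \<in> K; \<alpha> i = 0\<rbrakk> \<Longrightarrow> \<beta> i = 0"
    and ex: "\<exists>i\<in>K. \<beta> i > 0"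
  obtains t where "\<And>i. i \<in> K \<Longrightarrow> \<alpha> i + t * \<beta> i \<le> 0"
    and "{i \<in> K. \<alpha> i = 0} \<subset> {i \<in> K. \<alpha> i + t * \<beta> i = 0}"
proof -
  define P where "P = {i \<in> K. \<beta> i > 0}"
  define t where "t = Min ((\<lambda>i. - \<alpha> i / \<beta> i) ` P)"
  have fin: "finite P" "P \<noteq> {}"
    using assms(1) ex by (auto simp: P_def)
  then have "t \<in> (\<lambda>i. - \<alpha> i / \<beta> i) ` P"
    unfolding t_def by (intro Min_in) auto
  then obtain j where j: "j \<in> P" "t = - \<alpha> j / \<beta> j"
    by blast
  have t0: "t \<ge> 0"
    using j feas[of j] by (auto simp: P_def divide_nonpos_pos)
  have le: "\<alpha> i + t * \<beta> i \<le> 0" if "i \<in> K" for i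
  proof (cases "\<beta> i > 0")
    case True
    then have "t \<le> - \<alpha> i / \<beta> i"
      using that fin unfolding t_def by (intro Min_le) (auto simp: P_def)
    then show ?thesis
      using True by (simp add: field_simps)
  next
    case False
    then have "t * \<beta> i \<le> 0"
      using t0 by (simp add: mult_nonneg_nonpos)
    then show ?thesis
      using feas[OF that] by linarith
  qed
  have "\<alpha> j + t * \<beta> j = 0" "\<alpha> j \<noteq> 0" "j \<in> K"
    using j tight[of j] by (auto simp: P_def)
  then have "{i \<in> K. \<alpha> i = 0} \<subset> {i \<in> K. \<alpha> i + t * \<beta> i = 0}"
    using tight by auto
  then show ?thesis
    using that le by blast
qed

text \<open>By \<open>sat\<close>, \<open>U\<close> is a union of whole fibres of \<open>p\<close>.
  In the application \<open>p\<close> sends a vertex to the collection of tight sets containing it,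
  so every tight set qualifies.\<close>

lemma sum_zero_if_fibres_zero:
  fixes d :: "'v \<Rightarrow> real"
  assumes "finite V" "U \<subseteq> V" and fib: "\<And>c. (\<Sum>v | v \<in> V \<and> p v = c. d v) = 0"
    and sat: "\<And>u v. \<lbrakk>u \<in> U; v \<in> V; p u = p v\<rbrakk> \<Longrightarrow> v \<in> U"
  shows "sum d U = 0"
proof -
  have "finite U"
    using assms finite_subset by blast
  then have "sum d U = (\<Sum>c\<in>p ` U. \<Sum>v | v \<in> U \<and> p v = c. d v)"
    by (rule sum.image_gen)
  also have "\<dots> = (\<Sum>c\<in>p ` U. \<Sum>v | v \<in> V \<and> p v = c. d v)"
  proof (rule sum.cong[OF refl])
    fix c assume "c \<in> p ` U"
    then have "{v. v \<in> U \<and> p v = c} = {v. v \<in> V \<and> p v = c}"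
      using sat assms(2) by fastforce
    then show "(\<Sum>v | v \<in> U \<and> p v = c. d v) = (\<Sum>v | v \<in> V \<and> p v = c. d v)"
      by simp
  qed
  finally show ?thesis
    using fib by simp
qed

text \<open>Uncrossing: \<open>sum y\<close> is modular, so for tight \<open>U\<close> and
  \<open>W\<close> submodularity bounds the \<open>f\<close>-values of intersection and union by
  their \<open>y\<close>-sums, while feasibility gives the reverse inequality for each of
  them.\<close>

lemma crossing_family_tight:
  fixes y :: "'v \<Rightarrow> real" and f :: "'v set \<Rightarrow> real"
  assumes "finite V" "crossing_family V C"
    and submod: "\<And>U W. \<lbrakk>U \<in> C; W \<in> C; U \<inter> W \<noteq> {}; U \<union> W \<noteq> V\<rbrakk>
      \<Longrightarrow> f (U \<inter> W) + f (U \<union> W) \<le> f U + f W"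
    and feas: "\<And>U. U \<in> C \<Longrightarrow> sum y U \<le> f U"
  shows "crossing_family V {U \<in> C. sum y U = f U}"
  unfolding crossing_family_def
proof (intro conjI ballI impI)
  show "{U \<in> C. sum y U = f U} \<subseteq> Pow V"
    using assms(2) by (auto simp: crossing_family_def)
next
  fix U W assume UW: "U \<in> {U \<in> C. sum y U = f U}" "W \<in> {U \<in> C. sum y U = f U}"
    and cr: "U \<inter> W \<noteq> {} \<and> U \<union> W \<noteq> V"
  have C: "U \<inter> W \<in> C" "U \<union> W \<in> C"
    using assms(2) UW cr unfolding crossing_family_def by blast+
  have "finite U" "finite W"
    using assms(1,2) UW unfolding crossing_family_def by (auto intro: finite_subset)
  then have "sum y (U \<union> W) + sum y (U \<inter> W) = sum y U + sum y W"
    by (rule sum.union_inter)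
  moreover have "f (U \<inter> W) + f (U \<union> W) \<le> f U + f W"
    using submod UW cr by auto
  ultimately have "sum y (U \<inter> W) = f (U \<inter> W)" "sum y (U \<union> W) = f (U \<union> W)"
    using feas[OF C(1)] feas[OF C(2)] UW by auto
  then show "U \<inter> W \<in> {U \<in> C. sum y U = f U}" "U \<union> W \<in> {U \<in> C. sum y U = f U}"
    using C by auto
qed

text \<open>The sum over the atom of \<open>v\<close> is integral, so \<open>v\<close> cannot be its
  only fractional point.\<close>

lemma no_singleton_atom:
  fixes y :: "'v \<Rightarrow> real"
  assumes "finite V" "crossing_family V F" "sum y V \<in> \<int>" "\<And>U. U \<in> F \<Longrightarrow> sum y U \<in> \<int>"
    and "v \<in> V" "y v \<notin> \<int>"
  shows "\<exists>w\<in>{v \<in> V. y v \<notin> \<int>}. w \<noteq> v \<and> {U \<in> F. w \<in> U} = {U \<in> F. v \<in> U}"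
proof (rule ccontr)
  assume no: "\<not> ?thesis"
  let ?B = "{u \<in> V. {U \<in> F. u \<in> U} = {U \<in> F. v \<in> U}}"
  have "sum y ?B = y v + sum y (?B - {v})"
    using assms by (intro sum.remove) auto
  moreover have "sum y (?B - {v}) \<in> \<int>"
    using no by (intro Ints_sum) auto
  moreover have "sum y ?B \<in> \<int>"
    by (rule sum_atom_Ints[OF assms(1-5)])
  ultimately have "y v \<in> \<int>"
    using Ints_diff[of "sum y ?B" "sum y (?B - {v})"] by simp
  then show False
    using assms by simp
qed

text \<open>
  Among the points satisfying the constraints and lying in a fixed unit cube, one with the most
  tight constraints is integral: tight sets split \<open>V\<close> into two partitions with integral block sums,
  so a block never contains a single fractional vertex, and there is a direction supported on
  fractional vertices that keeps all tight constraints tight.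
\<close>

theorem base_polyhedra_intersection_integral:
  fixes f g :: "'v set \<Rightarrow> int" and y0 :: "'v \<Rightarrow> real" and k :: int
  assumes finV: "finite V" and cf: "crossing_family V C"
    and submod: "\<And>U W. \<lbrakk>U \<in> C; W \<in> C; U \<inter> W \<noteq> {}; U \<union> W \<noteq> V\<rbrakk>
      \<Longrightarrow> f (U \<inter> W) + f (U \<union> W) \<le> f U + f W"
    and supermod: "\<And>U W. \<lbrakk>U \<in> C; W \<in> C; U \<inter> W \<noteq> {}; U \<union> W \<noteq> V\<rbrakk>
      \<Longrightarrow> g U + g W \<le> g (U \<inter> W) + g (U \<union> W)"
    and y0: "\<And>U. U \<in> C \<Longrightarrow> g U \<le> sum y0 U \<and> sum y0 U \<le> f U" "sum y0 V = k"
  obtains y :: "'v \<Rightarrow> int"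
  where "\<And>U. U \<in> C \<Longrightarrow> g U \<le> sum y U \<and> sum y U \<le> f U" and "sum y V = k"
proof -
  define l where "l v = \<lfloor>y0 v\<rfloor>" for v
  \<comment> \<open>A triple \<open>(A, s, b)\<close> encodes the constraint
    \<open>s * sum y A \<le> b\<close>, so that upper bounds, lower bounds and the faces of the cube
    around \<open>y0\<close> are treated uniformly.\<close>
  define K :: "('v set \<times> real \<times> real) set" where
    "K = (\<lambda>U. (U, 1, of_int (f U))) ` C \<union> (\<lambda>U. (U, - 1, - of_int (g U))) ` C
       \<union> (\<lambda>v. ({v}, 1, of_int (l v) + 1)) ` V \<union> (\<lambda>v. ({v}, - 1, - of_int (l v))) ` V"
  define slack where "slack y i = (case i of (A, s, b) \<Rightarrow> s * sum y A - b)" for y :: "'v \<Rightarrow> real" and i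
  define feas where "feas y \<longleftrightarrow> sum y V = k \<and> (\<forall>i\<in>K. slack y i \<le> 0)" for y :: "'v \<Rightarrow> real"
  define tight where "tight y = {i \<in> K. slack y i = 0}" for y :: "'v \<Rightarrow> real"
  have Csub: "C \<subseteq> Pow V"
    using cf by (simp add: crossing_family_def)
  then have finC: "finite C"
    using finV finite_subset by auto
  have finK: "finite K"
    using finV finC by (simp add: K_def)
  have feas_iff: "feas y \<longleftrightarrow> sum y V = k \<and> (\<forall>U\<in>C. g U \<le> sum y U \<and> sum y U \<le> f U)
      \<and> (\<forall>v\<in>V. l v \<le> y v \<and> y v \<le> l v + 1)" for y :: "'v \<Rightarrow> real"
    unfolding feas_def K_def slack_def ball_Un ball_simps by auto
  have "feas y0"
    unfolding feas_iff using y0 by (auto simp: l_def)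
  moreover have "card (tight y) < Suc (card K)" for y
    using finK by (simp add: tight_def less_Suc_eq_le card_mono)
  ultimately obtain y where y: "feas y" and max: "\<And>y'. feas y' \<Longrightarrow> card (tight y') \<le> card (tight y)"
    using ex_has_greatest_nat[of feas y0 "\<lambda>y. card (tight y)" "Suc (card K)"] by auto
  define N where "N = {v \<in> V. y v \<notin> \<int>}"
  have "N = {}"
  proof (rule ccontr)
    assume ne: "N \<noteq> {}"
    define F where "F = {U \<in> C. sum y U = f U}"
    define H where "H = {U \<in> C. sum y U = g U}"
    have F: "crossing_family V F"
      unfolding F_def
    proof (rule crossing_family_tight[OF finV cf])
      show "real_of_int (f (U \<inter> W)) + f (U \<union> W) \<le> real_of_int (f U) + f W"
        if "U \<in> C" "W \<in> C" "U \<inter> W \<noteq> {}" "U \<union> W \<noteq> V" for U W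
        using submod[OF that] by linarith
    qed (use y feas_iff in auto)
    \<comment> \<open>Negating \<open>y\<close> and \<open>g\<close> turns the supermodular lower
      bound into a submodular upper bound.\<close>
    have "crossing_family V {U \<in> C. sum (\<lambda>v. - y v) U = - real_of_int (g U)}"
    proof (rule crossing_family_tight[OF finV cf])
      show "- real_of_int (g (U \<inter> W)) + - real_of_int (g (U \<union> W))
          \<le> - real_of_int (g U) + - real_of_int (g W)"
        if "U \<in> C" "W \<in> C" "U \<inter> W \<noteq> {}" "U \<union> W \<noteq> V" for U W
        using supermod[OF that] by linarith
    qed (use y feas_iff in \<open>auto simp: sum_negf\<close>)
    then have H: "crossing_family V H"
      by (simp add: sum_negf H_def)
    have yV: "sum y V \<in> \<int>"
      using y by (simp add: feas_iff)
    have finN: "finite N"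
      using finV by (simp add: N_def)
    have pF: "\<exists>w\<in>N. w \<noteq> v \<and> {U \<in> F. w \<in> U} = {U \<in> F. v \<in> U}" if "v \<in> N" for v
      using that unfolding N_def by (intro no_singleton_atom[OF finV F yV]) (auto simp: F_def)
    have pH: "\<exists>w\<in>N. w \<noteq> v \<and> {U \<in> H. w \<in> U} = {U \<in> H. v \<in> U}" if "v \<in> N" for v
      using that unfolding N_def by (intro no_singleton_atom[OF finV H yV]) (auto simp: H_def)
    obtain d0 :: "'v \<Rightarrow> real" where d0: "\<exists>v\<in>N. d0 v \<noteq> 0"
      "\<And>c. (\<Sum>v | v \<in> N \<and> {U \<in> F. v \<in> U} = c. d0 v) = 0"
      "\<And>c. (\<Sum>v | v \<in> N \<and> {U \<in> H. v \<in> U} = c. d0 v) = 0"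
      using two_partitions_kernel[OF finN ne pF pH] by blast
    define d where "d v = (if v \<in> N then d0 v else 0)" for v
    have ext: "(\<Sum>v | v \<in> V \<and> P v. d v) = (\<Sum>v | v \<in> N \<and> P v. d0 v)" for P
      using finV by (intro sum.mono_neutral_cong_right) (auto simp: d_def N_def)
    have dF: "(\<Sum>v | v \<in> V \<and> {U \<in> F. v \<in> U} = c. d v) = 0" for c
      by (simp only: ext d0)
    have dH: "(\<Sum>v | v \<in> V \<and> {U \<in> H. v \<in> U} = c. d v) = 0" for c
      by (simp only: ext d0)
    have dV: "sum d V = 0"
      by (rule sum_zero_if_fibres_zero[OF finV _ dF]) auto
    have dFU: "sum d U = 0" if "U \<in> F" for U
      by (rule sum_zero_if_fibres_zero[OF finV _ dF]) (use that Csub in \<open>auto simp: F_def\<close>)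
    have dHU: "sum d U = 0" if "U \<in> H" for U
      by (rule sum_zero_if_fibres_zero[OF finV _ dH]) (use that Csub in \<open>auto simp: H_def\<close>)
    define \<beta> where "\<beta> i = (case i of (A, s, b) \<Rightarrow> s * sum d A)" for i :: "'v set \<times> real \<times> real"
    have slack_move: "slack (\<lambda>v. y v + t * d v) i = slack y i + t * \<beta> i" for t i
      unfolding slack_def \<beta>_def
      by (cases i) (simp add: sum.distrib sum_distrib_left algebra_simps)
    \<comment> \<open>For tight members of \<open>C\<close> this is the vanishing of
      \<open>d\<close> on \<open>F\<close> and \<open>H\<close>. A tight cube face at
      \<open>v\<close> forces \<open>y v\<close> to be an integer, and \<open>d\<close> vanishes
      there.\<close>
    have tight0: "\<beta> i = 0" if "i \<in> K" "slack y i = 0" for i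
    proof -
      have out: "d v = 0" if "y v \<in> \<int>" for v
        using that by (simp add: d_def N_def)
      have "y v = of_int (l v) + 1 \<Longrightarrow> d v = 0" "y v = of_int (l v) \<Longrightarrow> d v = 0" for v
        by (auto intro!: out)
      then show ?thesis
        using that dFU dHU unfolding K_def slack_def \<beta>_def F_def H_def
        by (auto simp: algebra_simps)
    qed
    \<comment> \<open>The two cube faces at a vertex \<open>v\<close> with
      \<open>d v \<noteq> 0\<close> have rates \<open>d v\<close> and \<open>- d v\<close>, so one
      of them is approached.\<close>
    have "\<exists>i\<in>K. \<beta> i > 0"
    proof -
      obtain v where v: "v \<in> V" "d v \<noteq> 0"
        using d0(1) by (auto simp: d_def N_def)
      then have "({v}, 1, of_int (l v) + 1) \<in> K" "({v}, - 1, - of_int (l v)) \<in> K"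
        by (auto simp: K_def)
      moreover have "\<beta> ({v}, 1, of_int (l v) + 1) > 0 \<or> \<beta> ({v}, - 1, - of_int (l v)) > 0"
        using v by (auto simp: \<beta>_def)
      ultimately show ?thesis
        by blast
    qed
    then obtain t where t: "\<And>i. i \<in> K \<Longrightarrow> slack y i + t * \<beta> i \<le> 0"
      "{i \<in> K. slack y i = 0} \<subset> {i \<in> K. slack y i + t * \<beta> i = 0}"
      using move_until_tight[of K "slack y" \<beta>] finK y tight0 unfolding feas_def by blast
    let ?y = "\<lambda>v. y v + t * d v"
    have "sum ?y V = k"
      using y dV by (simp add: feas_def sum.distrib sum_distrib_left[symmetric])
    then have "feas ?y"
      using t(1) by (simp add: feas_def slack_move)
    moreover have "card (tight y) < card (tight ?y)"
      using t(2) finK unfolding tight_def slack_move by (intro psubset_card_mono) auto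
    ultimately show False
      using max by (meson leD)
  qed
  then have fl: "of_int \<lfloor>y v\<rfloor> = y v" if "v \<in> V" for v
    using that by (auto simp: N_def elim: Ints_cases)
  have sum_fl: "real_of_int (\<Sum>v\<in>U. \<lfloor>y v\<rfloor>) = sum y U" if "U \<subseteq> V" for U
    using that fl by (auto intro!: sum.cong)
  show ?thesis
  proof (rule that[of "\<lambda>v. \<lfloor>y v\<rfloor>"])
    show "g U \<le> (\<Sum>v\<in>U. \<lfloor>y v\<rfloor>) \<and> (\<Sum>v\<in>U. \<lfloor>y v\<rfloor>) \<le> f U" if "U \<in> C" for U
      using y that sum_fl[of U] Csub unfolding feas_iff by (metis PowD of_int_le_iff subsetD)
    show "(\<Sum>v\<in>V. \<lfloor>y v\<rfloor>) = k"
      using y sum_fl[of V] unfolding feas_iff by (metis of_int_eq_iff order_refl)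
  qed
qed

section \<open>Flows and orientations\<close>

text \<open>A unit of flow is sent along a walk from \<open>u\<close> to \<open>v\<close>, by
  induction on the walk.\<close>

lemma path_flow:
  fixes t h :: "'e \<Rightarrow> 'v"
  assumes "finite E" and th: "\<And>e. e \<in> E \<Longrightarrow> {t e, h e} = ends e"
    and "(u, v) \<in> (adjacency E ends)\<^sup>*"
  shows "\<exists>x :: 'e \<Rightarrow> int. \<forall>w. (\<Sum>e\<in>E. x e * (of_bool (t e = w) - of_bool (h e = w)))
           = of_bool (u = w) - of_bool (v = w)"
  using assms(3)
proof (induction rule: rtrancl_induct)
  case base
  show ?case
    by (intro exI[of _ "\<lambda>_. 0"]) simp
next
  case (step v v')
  then obtain x :: "'e \<Rightarrow> int" where x:
    "\<And>w. (\<Sum>e\<in>E. x e * (of_bool (t e = w) - of_bool (h e = w))) = of_bool (u = w) - of_bool (v = w)"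
    by blast
  obtain a where a: "a \<in> E" "ends a = {v, v'}"
    using step.hyps by (auto simp: adjacency_def)
  \<comment> \<open>The sign records whether the walk traverses \<open>a\<close> along or against
    the reference orientation. It is added to \<open>x a\<close>, since the walk may already have
    used \<open>a\<close>; a loop contributes 0 to both sides of \<open>eq\<close>.\<close>
  define s :: int where "s = (if t a = v then 1 else - 1)"
  have eq: "s * (of_bool (t a = w) - of_bool (h a = w)) = of_bool (v = w) - of_bool (v' = w)" for w
    using th[OF a(1)] a(2) by (auto simp: s_def doubleton_eq_iff)
  have "(\<Sum>e\<in>E. (x e + s * of_bool (e = a)) * (of_bool (t e = w) - of_bool (h e = w)))
      = of_bool (u = w) - of_bool (v' = w)" for w
  proof -
    have "(\<Sum>e\<in>E. s * of_bool (e = a) * (of_bool (t e = w) - of_bool (h e = w)))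
        = (\<Sum>e\<in>E. if e = a then s * (of_bool (t a = w) - of_bool (h a = w)) else 0)"
      by (rule sum.cong) auto
    also have "\<dots> = of_bool (v = w) - of_bool (v' = w)"
      using assms(1) a(1) eq by simp
    finally show ?thesis
      using x[of w] by (simp add: distrib_right sum.distrib)
  qed
  then show ?case
    by (intro exI[of _ "\<lambda>e. x e + s * of_bool (e = a)"]) simp
qed

text \<open>Each \<open>v\<close> sends \<open>y v\<close> units to a common root \<open>r\<close>.
  The root receives \<open>sum y V = 0\<close> in total, so its net outflow is also correct.\<close>

lemma integer_flow:
  fixes t h :: "'e \<Rightarrow> 'v" and y :: "'v \<Rightarrow> int"
  assumes "finite V" "finite E" and th: "\<And>e. e \<in> E \<Longrightarrow> {t e, h e} = ends e"
    and conn: "connected_multigraph V E ends" and "sum y V = 0"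
  obtains x :: "'e \<Rightarrow> int"
  where "\<And>w. w \<in> V \<Longrightarrow> (\<Sum>e\<in>E. x e * (of_bool (t e = w) - of_bool (h e = w))) = y w"
proof (cases "V = {}")
  case True
  then show ?thesis
    using that by blast
next
  case False
  then obtain r where r: "r \<in> V"
    by blast
  have ex: "\<forall>v\<in>V. \<exists>x :: 'e \<Rightarrow> int. \<forall>w. (\<Sum>e\<in>E. x e * (of_bool (t e = w) - of_bool (h e = w)))
           = of_bool (v = w) - of_bool (r = w)"
    using conn r path_flow[OF assms(2), of t h ends] th unfolding connected_multigraph_def by blast
  then obtain X :: "'v \<Rightarrow> 'e \<Rightarrow> int" where X: "\<And>v w. v \<in> V \<Longrightarrow>
      (\<Sum>e\<in>E. X v e * (of_bool (t e = w) - of_bool (h e = w))) = of_bool (v = w) - of_bool (r = w)"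
    using bchoice[OF ex] by blast
  show ?thesis
  proof (rule that[of "\<lambda>e. \<Sum>v\<in>V. y v * X v e"])
    fix w assume w: "w \<in> V"
    have "(\<Sum>e\<in>E. (\<Sum>v\<in>V. y v * X v e) * (of_bool (t e = w) - of_bool (h e = w)))
        = (\<Sum>v\<in>V. y v * (\<Sum>e\<in>E. X v e * (of_bool (t e = w) - of_bool (h e = w))))"
      unfolding sum_distrib_left sum_distrib_right by (subst sum.swap) (simp only: mult.assoc)
    also have "\<dots> = (\<Sum>v\<in>V. y v * of_bool (v = w)) - sum y V * of_bool (r = w)"
    proof -
      have "(\<Sum>v\<in>V. y v * (\<Sum>e\<in>E. X v e * (of_bool (t e = w) - of_bool (h e = w))))
          = (\<Sum>v\<in>V. y v * (of_bool (v = w) - of_bool (r = w)))"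
        using X by (intro sum.cong) simp_all
      then show ?thesis
        by (simp only: right_diff_distrib sum_subtractf sum_distrib_right)
    qed
    also have "(\<Sum>v\<in>V. y v * of_bool (v = w)) = (\<Sum>v\<in>V. if v = w then y v else 0)"
      by (rule sum.cong) auto
    also have "\<dots> = y w"
      using assms(1) w by simp
    finally show "(\<Sum>e\<in>E. (\<Sum>v\<in>V. y v * X v e) * (of_bool (t e = w) - of_bool (h e = w))) = y w"
      using assms(5) by simp
  qed
qed

text \<open>After exchanging the sums, an edge with both ends in \<open>U\<close> cancels. The
  coefficients are left general because the identity serves both the real vector \<open>y0\<close>
  and the integer flow \<open>x\<close>.\<close>

lemma sum_net_outflow:
  fixes x :: "'e \<Rightarrow> 'a::comm_ring_1"
  assumes "finite U"
  shows "(\<Sum>w\<in>U. \<Sum>e\<in>E. x e * (of_bool (t e = w) - of_bool (h e = w)))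
       = (\<Sum>e\<in>E. x e * (of_bool (t e \<in> U) - of_bool (h e \<in> U)))"
proof -
  have "(\<Sum>w\<in>U. of_bool (a = w) :: 'a) = of_bool (a \<in> U)" for a
    using assms by (simp add: of_bool_def)
  then show ?thesis
    by (subst sum.swap) (simp add: sum_subtractf flip: sum_distrib_left)
qed

theorem theorem1:
  fixes V :: "'v set" and E :: "'e set" and ends :: "'e \<Rightarrow> 'v set"
    and C :: "'v set set"
  assumes "fin_multigraph V E ends"
    and "connected_multigraph V E ends"
    and "crossing_family V C"
    and "\<And>U. U \<in> C \<Longrightarrow> card (cut_edges V E ends U) \<ge> 2"
  shows "\<exists>D :: ('v, 'e) pre_digraph. strong_orientation V E ends C D"
proof -
  interpret fin_multigraph V E ends by fact
  have "\<forall>e\<in>E. \<exists>u v. u \<in> V \<and> v \<in> V \<and> {u, v} = ends e"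
    using ends_edge by metis
  then obtain t h where th: "\<And>e. e \<in> E \<Longrightarrow> t e \<in> V \<and> h e \<in> V \<and> {t e, h e} = ends e"
    by metis
  have Csub: "U \<subseteq> V" if "U \<in> C" for U
    using assms(3) that by (auto simp: crossing_family_def)
  define out :: "'v set \<Rightarrow> int" where "out U = (\<Sum>e\<in>E. of_bool (t e \<in> U \<and> h e \<notin> U))" for U
  define inn :: "'v set \<Rightarrow> int" where "inn U = (\<Sum>e\<in>E. of_bool (t e \<notin> U \<and> h e \<in> U))" for U
  have cut: "out U + inn U \<ge> 2" if "U \<in> C" for U
  proof -
    have "cut_edges V E ends U = {e \<in> E. (t e \<in> U \<and> h e \<notin> U) \<or> (t e \<notin> U \<and> h e \<in> U)}"
      unfolding cut_edges_def using th by (fastforce simp: doubleton_eq_iff)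
    moreover have "out U + inn U
        = (\<Sum>e\<in>E. of_bool ((t e \<in> U \<and> h e \<notin> U) \<or> (t e \<notin> U \<and> h e \<in> U)))"
      unfolding out_def inn_def sum.distrib[symmetric] by (rule sum.cong) auto
    ultimately have "out U + inn U = int (card (cut_edges V E ends U))"
      using finite_E by (simp add: of_bool_def sum.If_cases Int_def)
    then show ?thesis
      using assms(4)[OF that] by linarith
  qed
  define y0 :: "'v \<Rightarrow> real" where
    "y0 w = (\<Sum>e\<in>E. 1 / 2 * (of_bool (t e = w) - of_bool (h e = w)))" for w
  have y0_sum: "sum y0 U = (out U - inn U) / 2" if "U \<subseteq> V" for U
  proof -
    have "finite U"
      using that finite_V finite_subset by blast
    then have "sum y0 U = (\<Sum>e\<in>E. 1 / 2 * (of_bool (t e \<in> U) - of_bool (h e \<in> U)))"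
      unfolding y0_def by (rule sum_net_outflow)
    also have "\<dots> = (\<Sum>e\<in>E. 1 / 2 * (of_bool (t e \<in> U \<and> h e \<notin> U) - of_bool (t e \<notin> U \<and> h e \<in> U)))"
      by (rule sum.cong) auto
    also have "\<dots> = (out U - inn U) / 2"
      by (simp only: sum_distrib_left[symmetric] sum_subtractf) (simp add: out_def inn_def)
    finally show ?thesis .
  qed
  \<comment> \<open>Both inequalities hold edge by edge. The one for \<open>inn\<close> makes the
    lower bound \<open>1 - inn U\<close> supermodular.\<close>
  have submod: "out (U \<inter> W) + out (U \<union> W) \<le> out U + out W"
    "inn (U \<inter> W) + inn (U \<union> W) \<le> inn U + inn W" for U W
    unfolding out_def inn_def sum.distrib[symmetric] by (rule sum_mono; auto)+
  \<comment> \<open>With \<open>sum y0 U = (out U - inn U) / 2\<close>, each of the two bounds is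
    equivalent to \<open>out U + inn U \<ge> 2\<close>.\<close>
  have "1 - inn U \<le> sum y0 U \<and> sum y0 U \<le> out U - 1" if "U \<in> C" for U
    using cut[OF that] y0_sum[OF Csub[OF that]] by auto
  moreover have "sum y0 V = 0"
    using y0_sum[of V] th by (simp add: out_def inn_def)
  ultimately obtain y :: "'v \<Rightarrow> int" where
    y: "\<And>U. U \<in> C \<Longrightarrow> 1 - inn U \<le> sum y U \<and> sum y U \<le> out U - 1" "sum y V = 0"
    using base_polyhedra_intersection_integral[of V C "\<lambda>U. out U - 1" "\<lambda>U. 1 - inn U" y0 0]
      finite_V assms(3) submod by (smt (verit, best) of_int_0 of_int_1 of_int_diff)
  obtain x :: "'e \<Rightarrow> int" where
    x: "\<And>w. w \<in> V \<Longrightarrow> (\<Sum>e\<in>E. x e * (of_bool (t e = w) - of_bool (h e = w))) = y w"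
    using integer_flow[OF finite_V finite_E _ assms(2) y(2), of t h] th by blast
  have y_sum: "sum y U = (\<Sum>e\<in>E. x e * (of_bool (t e \<in> U) - of_bool (h e \<in> U)))" if "U \<in> C" for U
  proof -
    have "finite U"
      using that Csub finite_V finite_subset by blast
    moreover have "sum y U = (\<Sum>w\<in>U. \<Sum>e\<in>E. x e * (of_bool (t e = w) - of_bool (h e = w)))"
      by (rule sum.cong[OF refl]) (use x Csub[OF that] in auto)
    ultimately show ?thesis
      by (simp only: sum_net_outflow)
  qed
  define D :: "('v, 'e) pre_digraph" where
    "D = \<lparr>verts = V, arcs = E, tail = (\<lambda>e. if x e \<ge> 1 then t e else h e),
          head = (\<lambda>e. if x e \<ge> 1 then h e else t e)\<rparr>"
  have "orientation V E ends D"
    unfolding orientation_def D_def using th by (auto simp: insert_commute)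
  moreover have "arcs_leaving D U \<noteq> {}" if "U \<in> C" for U
  proof
    assume none: "arcs_leaving D U = {}"
    have "sum y U \<le> (\<Sum>e\<in>E. - of_bool (t e \<notin> U \<and> h e \<in> U))"
      unfolding y_sum[OF that]
    proof (rule sum_mono)
      fix e assume "e \<in> E"
      then show "x e * (of_bool (t e \<in> U) - of_bool (h e \<in> U)) \<le> - of_bool (t e \<notin> U \<and> h e \<in> U)"
        using none th[of e] unfolding arcs_leaving_def D_def by (auto split: if_splits)
    qed
    then show False
      using y(1)[OF that] by (simp add: inn_def sum_negf)
  qed
  moreover have "arcs_entering D U \<noteq> {}" if "U \<in> C" for U
  proof
    assume none: "arcs_entering D U = {}"
    \<comment> \<open>With no entering arc, reference edges leaving \<open>U\<close> were kept, so
      \<open>x e \<ge> 1\<close>, and those entering \<open>U\<close> were reversed, so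
      \<open>x e \<le> 0\<close>. This gives \<open>out U \<le> sum y U\<close>, against the upper
      bound \<open>out U - 1\<close>.\<close>
    have "(\<Sum>e\<in>E. of_bool (t e \<in> U \<and> h e \<notin> U)) \<le> sum y U"
      unfolding y_sum[OF that]
    proof (rule sum_mono)
      fix e assume "e \<in> E"
      then show "of_bool (t e \<in> U \<and> h e \<notin> U) \<le> x e * (of_bool (t e \<in> U) - of_bool (h e \<in> U))"
        using none th[of e] unfolding arcs_entering_def D_def by (auto split: if_splits)
    qed
    then show False
      using y(1)[OF that] by (simp add: out_def)
  qed
  ultimately show ?thesis
    unfolding strong_orientation_def by blast
qed

end
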